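(* For every real number $t\in(0,\infty)$, $$\frac{1+2t}{2t^2}\left[\ln\Gamma\left(\frac{t}{1+2t}\right)-\ln\Gamma(t)\right]<1-\psi(t).$$
   Context: $\Gamma(x)=\int_0^\infty u^{x-1}e^{-u}\,du$ for $x>0$ is the classical Euler gamma function, and $\psi(x)=\frac{\Gamma'(x)}{\Gamma(x)}$ for $x>0$ is its logarithmic derivative (the psi or digamma function). *)

theory Defs
  imports "HOL-Analysis.Analysis"
begin

(* The library introduces Gamma and Digamma by a limit and a series; on the positive reals
   they are Euler's integral and the logarithmic derivative of Gamma. *)

lemma Gamma_real_eq_Euler_integral:
  fixes x :: real
  assumes "x > 0"
  shows "((\<lambda>u. u powr (x - 1) * exp (- u)) has_integral Gamma x) {0..}"
  using Gamma_integral_real[OF assms] by (simp add: exp_minus field_simps)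

lemma Digamma_real_eq_logderiv:
  fixes x :: real
  assumes "x > 0"
  shows "Digamma x = deriv Gamma x / Gamma x"
proof -
  have "x \<notin> \<int>\<^sub>\<le>\<^sub>0"
    using assms by (auto elim!: nonpos_Ints_cases)
  then have "deriv Gamma x = Gamma x * Digamma x"
    by (intro DERIV_imp_deriv has_field_derivative_Gamma)
  then show ?thesis
    using Gamma_real_pos[OF assms] by simp
qed

end

theory Submission
  imports Defs
begin

text \<open>
  Put \<open>s = t / (1 + 2t)\<close>, that is \<open>1/s = 1/t + 2\<close>. Then \<open>t - s = 2t\<^sup>2 / (1 + 2t)\<close> is the reciprocal
  of the factor in the inequality, so the claim is that \<open>ln \<Gamma>(t) - ln \<Gamma>(s)\<close> exceeds
  \<open>(t - s) (\<psi>(t) - 1)\<close>. The two sides agree in the limit \<open>t \<rightarrow> 0\<close>, and their difference increases.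

  Since \<open>\<Gamma>\<close> and \<open>\<psi>\<close> are singular at \<open>0\<close>, their functional equations are used to move the
  arguments to \<open>t + 1\<close> and \<open>s + 1\<close>. This replaces the singular parts by \<open>ln (t/s) = ln (1 + 2t)\<close> and
  \<open>(t - s)/t = 2t / (1 + 2t)\<close>, and shows that the difference is a function that is differentiable
  on \<open>[0, \<infinity>)\<close> and vanishes at \<open>0\<close> (lemma \<open>regularised_ln_Gamma_diff_pos\<close>).

  Multiplied by \<open>(1 + 2t)\<^sup>2\<close>, its derivative is
  \<open>\<psi>(t + 1) - \<psi>(s + 1) + 4t\<^sup>2 - 2t\<^sup>2 (1 + 2t) \<psi>'(t + 1)\<close>. As \<open>\<psi>'\<close> decreases, the mean
  value theorem bounds \<open>\<psi>(t + 1) - \<psi>(s + 1)\<close> below by \<open>(t - s) \<psi>'(t + 1)\<close>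
  (lemma \<open>Digamma_real_diff_ge\<close>), and with this bound positivity amounts to
  \<open>\<psi>'(t + 1) < (1/t + 1/(t + 1)) / 2\<close> (lemma \<open>Trigamma_real_plus1_less\<close>), which can be read off
  from the series of \<open>\<psi>'\<close>.
\<close>

text \<open>
  The left-hand side is the sum of \<open>1 / (x + k)\<^sup>2\<close> over \<open>k \<ge> 1\<close>, while the right-hand side is the
  sum of the larger terms \<open>1 / ((x + k)\<^sup>2 - 1)\<close>, which telescopes by partial fractions.
\<close>
lemma Trigamma_real_plus1_less:
  fixes x :: real
  assumes "x > 0"
  shows "Polygamma 1 (x + 1) < (1 / x + 1 / (x + 1)) / 2"
proof -
  define f where "f k = (1 / (x + real k) + 1 / (x + real k + 1)) / 2" for k
  have reciprocal_lim: "(\<lambda>k. 1 / (c + real k)) \<longlonglongrightarrow> 0" for c :: real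
    by (intro tendsto_divide_0[OF tendsto_const] filterlim_at_top_imp_at_infinity
          filterlim_tendsto_add_at_top[OF tendsto_const] filterlim_real_sequentially)
  have "f \<longlonglongrightarrow> 0"
    using tendsto_divide[OF tendsto_add[OF reciprocal_lim[of x] reciprocal_lim[of "x + 1"]]
        tendsto_const[of 2]]
    by (simp add: f_def[abs_def] add_ac)
  then have telescope: "(\<lambda>k. f k - f (Suc k)) sums f 0"
    using telescope_sums'[of f 0] by simp
  have trigamma: "(\<lambda>k. inverse ((x + 1 + real k) ^ 2)) sums Polygamma 1 (x + 1)"
    using Polygamma_LIMSEQ[of "x + 1" 1] assms by (simp add: numeral_2_eq_2)
  have term_less: "inverse ((x + 1 + real k) ^ 2) < f k - f (Suc k)" for k
  proof -
    define y where "y = x + 1 + real k"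
    have y: "y > 1"
      using assms by (simp add: y_def)
    then have "y ^ 2 - 1 > 0"
      by simp
    have "f k - f (Suc k) = (1 / (y - 1) - 1 / (y + 1)) / 2"
      by (simp add: f_def y_def add_ac diff_divide_distrib add_divide_distrib)
    also have "\<dots> = 1 / ((y - 1) * (y + 1))"
      using y by (simp add: divide_simps)
    also have "\<dots> = inverse (y ^ 2 - 1)"
      by (simp add: algebra_simps power2_eq_square inverse_eq_divide)
    finally show ?thesis
      using \<open>y ^ 2 - 1 > 0\<close> unfolding y_def[symmetric]
      by (simp add: less_imp_inverse_less)
  qed
  have "Polygamma 1 (x + 1) < f 0"
  proof -
    have "0 < (\<Sum>k. f k - f (Suc k) - inverse ((x + 1 + real k) ^ 2))"
      using sums_summable[OF sums_diff[OF telescope trigamma]] term_less by (intro suminf_pos) auto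
    then show ?thesis
      using sums_unique[OF sums_diff[OF telescope trigamma]] by simp
  qed
  then show ?thesis
    by (simp add: f_def)
qed

text \<open>
  A chord of the concave function \<open>\<psi>\<close> is steeper than its tangent at the right end.
\<close>
lemma Digamma_real_diff_ge:
  fixes x y :: real
  assumes "0 < x" "x < y"
  shows "(y - x) * Polygamma 1 y \<le> Digamma y - Digamma x"
proof -
  have "\<exists>z. x < z \<and> z < y \<and> Digamma y - Digamma x = (y - x) * Polygamma 1 z"
  proof (rule MVT2)
    fix z assume "x \<le> z" "z \<le> y"
    then have "z \<notin> \<int>\<^sub>\<le>\<^sub>0"
      using assms by (auto elim!: nonpos_Ints_cases)
    then show "(Digamma has_real_derivative Polygamma 1 z) (at z)"
      using has_field_derivative_Polygamma[of z 0] by simp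
  qed (use assms in auto)
  then obtain z where z: "x < z" "z < y" "Digamma y - Digamma x = (y - x) * Polygamma 1 z"
    by blast
  have "Polygamma 1 y \<le> Polygamma 1 z"
    using Polygamma_real_strict_antimono[of z y 1] z assms by simp
  then show ?thesis
    using z assms by (simp add: mult_left_mono)
qed

text \<open>
  With \<open>s = t / (1 + 2t)\<close>, this is what makes the derivative in \<open>regularised_ln_Gamma_diff_pos\<close>
  positive. The lower bound \<open>(t - s) \<psi>'(t + 1)\<close> for the difference of \<open>\<psi>\<close>-values leaves \<open>4t\<^sup>2 - (2t\<^sup>2 (1 + 2t) - 2t\<^sup>2 / (1 + 2t)) \<psi>'(t + 1)\<close>, which is a positive
  multiple of the gap in the upper bound \<open>(1 + 2t) / (2t (t + 1))\<close> for \<open>\<psi>'(t + 1)\<close>.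
\<close>
lemma Digamma_diff_gt_Trigamma_term:
  fixes t :: real
  assumes "t > 0"
  shows "2 * t ^ 2 * (1 + 2 * t) * Polygamma 1 (t + 1)
           < Digamma (t + 1) - Digamma (t / (1 + 2 * t) + 1) + 4 * t ^ 2"
proof -
  define P where "P = Polygamma 1 (t + 1)"
  have P: "P < (1 + 2 * t) / (2 * t * (t + 1))"
    using Trigamma_real_plus1_less[OF assms] assms by (simp add: P_def field_simps)
  have shift: "t - t / (1 + 2 * t) = 2 * t ^ 2 / (1 + 2 * t)"
    using assms by (simp add: field_simps power2_eq_square)
  have "2 * t ^ 2 / (1 + 2 * t) > 0"
    using assms by simp
  with shift have "t / (1 + 2 * t) < t"
    by linarith
  with shift have "2 * t ^ 2 / (1 + 2 * t) * P \<le> Digamma (t + 1) - Digamma (t / (1 + 2 * t) + 1)"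
    using Digamma_real_diff_ge[of "t / (1 + 2 * t) + 1" "t + 1"] assms
    by (simp add: P_def add_pos_pos)
  moreover have "0 < 2 * t ^ 2 / (1 + 2 * t) * P + 4 * t ^ 2 - 2 * t ^ 2 * (1 + 2 * t) * P"
  proof -
    have "2 * t ^ 2 / (1 + 2 * t) * P + 4 * t ^ 2 - 2 * t ^ 2 * (1 + 2 * t) * P
        = 8 * t ^ 3 * (t + 1) / (1 + 2 * t) * ((1 + 2 * t) / (2 * t * (t + 1)) - P)"
      using assms by (simp add: divide_simps) (simp add: algebra_simps power2_eq_square power3_eq_cube)
    moreover have "8 * t ^ 3 * (t + 1) / (1 + 2 * t) > 0"
      using assms by simp
    moreover have "(1 + 2 * t) / (2 * t * (t + 1)) - P > 0"
      using P by simp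
    ultimately show ?thesis
      by (metis mult_pos_pos)
  qed
  ultimately show ?thesis
    unfolding P_def by linarith
qed

lemma ln_Gamma_plus1_real:
  fixes x :: real
  assumes "x > 0"
  shows "ln_Gamma (x + 1) = ln x + ln_Gamma x"
proof -
  have "x \<notin> \<int>\<^sub>\<le>\<^sub>0"
    using assms by (auto elim!: nonpos_Ints_cases)
  then show ?thesis
    using assms by (simp add: ln_Gamma_real_pos Gamma_plus1 ln_mult_pos)
qed

text \<open>
  The positive quantity is \<open>ln \<Gamma>(t) - ln \<Gamma>(s) - (t - s) (\<psi>(t) - 1)\<close> rewritten by the functional
  equations. In this form it makes sense and is differentiable at \<open>t = 0\<close> as well, so that it is
  enough to look at its value there and at the sign of its derivative.
\<close>
lemma regularised_ln_Gamma_diff_pos: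
  fixes t :: real
  assumes "t > 0"
  shows "0 < ln_Gamma (t + 1) - ln_Gamma (t / (1 + 2 * t) + 1) - ln (1 + 2 * t)
              - 2 * t ^ 2 / (1 + 2 * t) * (Digamma (t + 1) - 1) + 2 * t / (1 + 2 * t)"
proof -
  define G where "G = (\<lambda>t. ln_Gamma (t + 1) - ln_Gamma (t / (1 + 2 * t) + 1) - ln (1 + 2 * t)
              - 2 * t ^ 2 / (1 + 2 * t) * (Digamma (t + 1) - 1) + 2 * t / (1 + 2 * t :: real))"
  define N where "N x = Digamma (x + 1) - Digamma (x / (1 + 2 * x) + 1) + 4 * x ^ 2
              - 2 * x ^ 2 * (1 + 2 * x) * Polygamma 1 (x + 1)" for x :: real
  have deriv: "(G has_real_derivative N x / (1 + 2 * x) ^ 2) (at x)" if "x \<ge> 0" for x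
  proof -
    have pos: "x / (1 + 2 * x) + 1 > 0" "x + 1 > 0" "1 + 2 * x > 0"
      using that by (auto intro: add_nonneg_pos)
    have "((\<lambda>x. x / (1 + 2 * x) + 1) has_real_derivative 1 / (1 + 2 * x) ^ 2) (at x)"
      using pos by (auto intro!: derivative_eq_intros simp: field_simps power2_eq_square)
    from DERIV_chain2[OF has_field_derivative_ln_Gamma_real[OF pos(1)] this]
    have d1: "((\<lambda>x. ln_Gamma (x / (1 + 2 * x) + 1)) has_real_derivative
        Digamma (x / (1 + 2 * x) + 1) / (1 + 2 * x) ^ 2) (at x)"
      by simp
    have d2: "((\<lambda>x. ln_Gamma (x + 1)) has_real_derivative Digamma (x + 1)) (at x)"
      using pos by (auto intro!: derivative_eq_intros)
    have d3: "((\<lambda>x. ln (1 + 2 * x)) has_real_derivative 2 / (1 + 2 * x)) (at x)"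
      using pos by (auto intro!: derivative_eq_intros)
    \<comment> \<open>\<open>2x\<^sup>2 / (1 + 2x)\<close> is \<open>x - x / (1 + 2x)\<close>, which explains the form of its derivative.\<close>
    have d4: "((\<lambda>x. 2 * x ^ 2 / (1 + 2 * x)) has_real_derivative 1 - 1 / (1 + 2 * x) ^ 2) (at x)"
      using pos by (auto intro!: derivative_eq_intros simp: divide_simps)
        (simp add: algebra_simps power2_eq_square)
    have d5: "((\<lambda>x. 2 * x / (1 + 2 * x)) has_real_derivative 2 / (1 + 2 * x) ^ 2) (at x)"
      using pos by (auto intro!: derivative_eq_intros simp: divide_simps)
        (simp add: algebra_simps power2_eq_square)
    have "x + 1 \<notin> \<int>\<^sub>\<le>\<^sub>0"
      using that by (auto elim!: nonpos_Ints_cases)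
    then have d6: "((\<lambda>x. Digamma (x + 1) - 1) has_real_derivative Polygamma 1 (x + 1)) (at x)"
      by (auto intro!: derivative_eq_intros)
    \<comment> \<open>The terms free of \<open>\<psi>\<close> and \<open>\<psi>'\<close> add up to \<open>4x\<^sup>2 / (1 + 2x)\<^sup>2\<close>.\<close>
    have collect: "N x / (1 + 2 * x) ^ 2 = Digamma (x + 1)
        - Digamma (x / (1 + 2 * x) + 1) / (1 + 2 * x) ^ 2
        - 2 / (1 + 2 * x) - ((1 - 1 / (1 + 2 * x) ^ 2) * (Digamma (x + 1) - 1)
        + Polygamma 1 (x + 1) * (2 * x ^ 2 / (1 + 2 * x))) + 2 / (1 + 2 * x) ^ 2"
    proof -
      have "(A - B + 4 * x ^ 2 - 2 * x ^ 2 * (1 + 2 * x) * P) / (1 + 2 * x) ^ 2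
          = A - B / (1 + 2 * x) ^ 2 - 2 / (1 + 2 * x) - ((1 - 1 / (1 + 2 * x) ^ 2) * (A - 1)
            + P * (2 * x ^ 2 / (1 + 2 * x))) + 2 / (1 + 2 * x) ^ 2" for A B P
        using pos(3) by (simp add: divide_simps) (simp add: algebra_simps power2_eq_square)
      then show ?thesis
        unfolding N_def .
    qed
    show ?thesis
      unfolding G_def collect
      by (intro DERIV_add DERIV_diff DERIV_mult d1 d2 d3 d4 d5 d6)
  qed
  have "G 0 < G t"
  proof (rule DERIV_pos_imp_increasing_open[of 0 t G])
    fix x assume "0 < x" "x < t"
    then show "\<exists>y. DERIV G x :> y \<and> y > 0"
      using deriv[of x] Digamma_diff_gt_Trigamma_term[of x] by (auto simp: N_def)
  next
    show "continuous_on {0..t} G"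
      using deriv by (intro continuous_at_imp_continuous_on ballI DERIV_isCont) auto
  qed (fact assms)
  then show ?thesis
    by (simp add: G_def)
qed

theorem theorem1:
  fixes t :: real
  assumes "t > 0"
  shows "(1 + 2 * t) / (2 * t ^ 2) * (ln (Gamma (t / (1 + 2 * t))) - ln (Gamma t)) < 1 - Digamma t"
proof -
  define s where "s = t / (1 + 2 * t)"
  have s: "s > 0"
    using assms by (simp add: s_def)
  have "ln s = ln t - ln (1 + 2 * t)"
    using assms by (simp add: s_def ln_div)
  then have lnG: "ln_Gamma (t + 1) - ln_Gamma (s + 1) - ln (1 + 2 * t)
      = ln (Gamma t) - ln (Gamma s)"
    unfolding ln_Gamma_plus1_real[OF assms] ln_Gamma_plus1_real[OF s]
    using assms s by (simp add: ln_Gamma_real_pos)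
  define d where "d = 2 * t ^ 2 / (1 + 2 * t)"
  have d: "d > 0"
    using assms by (simp add: d_def)
  have "d * (Digamma (t + 1) - 1) - 2 * t / (1 + 2 * t) = d * (Digamma t - 1)"
    using assms
    by (simp add: d_def Digamma_plus1 divide_simps) (simp add: algebra_simps power2_eq_square)
  then have "0 < ln (Gamma t) - ln (Gamma s) - d * (Digamma t - 1)"
    using regularised_ln_Gamma_diff_pos[OF assms, folded s_def d_def] lnG by linarith
  then have "ln (Gamma s) - ln (Gamma t) < (1 - Digamma t) * d"
    by (simp add: algebra_simps)
  then have "(ln (Gamma s) - ln (Gamma t)) / d < 1 - Digamma t"
    using d by (simp add: pos_divide_less_eq)
  then show ?thesis
    by (simp add: s_def d_def mult.commute)
qed

end
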